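(* The lattice theoretical definition and the second (closure operator) definition of Faigle geometries are equivalent. That is, for every finite poset $P$ and every set $\mathcal F$ of subsets of $P$, the following two conditions are equivalent: (i) $(P,\mathcal F)$ satisfies (F$\cap$), (F$\downarrow$), (Pr), and (CP); (ii) $(P,\mathcal F)$ satisfies (F$\cap$), (F$\downarrow$), (Pr), and (FEP).
   Context: Let $P$ be a finite poset and let $\mathcal F$ be a subset of the power set $\mathrm{Pow}(P)=\{X: X\subseteq P\}$. A subset $X\subseteq P$ is a down-set of $P$ if for all $x\in X$ and $y\in P$, $y\le x$ implies $y\in X$. For $u\in P$, let ${\downarrow}_P u=\{x\in P: x\le u\}$ and ${\Downarrow}_P u=\{x\in P: x<u\}$. For $X,Y\in\mathcal F$, write $X\prec_{\mathcal F} Y$ if $Y$ covers $X$ in the poset $(\mathcal F,\subseteq)$, that is, $X\subsetneq Y$ and there is no $Z\in\mathcal F$ with $X\subsetneq Z\subsetneq Y$. For $X\subseteq P$, let $\mathrm{cl}_{\mathcal F}(X)=\bigcap\{Y\in\mathcal F: X\subseteq Y\}$. The conditions are: (F$\cap$) $P\in\mathcal F$, and $X\cap Y\in\mathcal F$ for all $X,Y\in\mathcal F$. (F$\downarrow$) Every member of $\mathcal F$ is a down-set of $P$. (Pr) $\emptyset\in\mathcal F$, and for each $u\in P$, both ${\downarrow}_P u$ and ${\Downarrow}_P u$ belong to $\mathcal F$. (CP) For any $u\in P$ and $X\in\mathcal F$ such that $u\notin X$ and ${\Downarrow}_P u\subseteq X$, there exists a $Y\in\mathcal F$ such that $X\prec_{\mathcal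 F} Y$ and $u\in Y$. (FEP) For any $u,v\in P$ and $S\in\mathcal F$, if $u\notin S$, $v\notin S$, ${\Downarrow}_P u\subseteq S$, and $v\in\mathrm{cl}_{\mathcal F}(S\cup\{u\})$, then $u\in\mathrm{cl}_{\mathcal F}(S\cup\{v\})$. The lattice theoretical definition calls $(P,\mathcal F)$ a Faigle geometry if (F$\cap$), (F$\downarrow$), (Pr), and (CP) hold. The second definition calls $(P,\mathcal F)$ a Faigle geometry if (F$\cap$), (F$\downarrow$), (Pr), and (FEP) hold. *)

theory Defs
  imports Main
begin

text \<open>
  A finite poset is given by a carrier \<open>P\<close> and a relation \<open>r\<close> with \<open>partial_order_on P r\<close>, where
  \<open>(x, y) \<in> r\<close> stands for \<open>x \<le> y\<close>; so the empty poset is included. The principal down-sets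
  \<open>\<down>u\<close> and \<open>\<Down>u\<close> are \<^const>\<open>under\<close> \<open>r u\<close> and \<^const>\<open>underS\<close> \<open>r u\<close>; these are subsets of \<open>P\<close>
  because \<open>partial_order_on P r\<close> entails \<open>r \<subseteq> P \<times> P\<close>.
\<close>

definition down_set :: "'a set \<Rightarrow> 'a rel \<Rightarrow> 'a set \<Rightarrow> bool" where
  "down_set P r X \<longleftrightarrow> X \<subseteq> P \<and> (\<forall>x\<in>X. \<forall>y\<in>P. (y, x) \<in> r \<longrightarrow> y \<in> X)"

definition covered_in :: "'a set set \<Rightarrow> 'a set \<Rightarrow> 'a set \<Rightarrow> bool" where
  "covered_in F X Y \<longleftrightarrow> X \<in> F \<and> Y \<in> F \<and> X \<subset> Y \<and> \<not> (\<exists>Z\<in>F. X \<subset> Z \<and> Z \<subset> Y)"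

text \<open>
  The intersection is taken in the whole type. When \<open>P \<in> F\<close> and \<open>X \<subseteq> P\<close> the family is nonempty,
  so the closure is a subset of \<open>P\<close>; it is used below only together with these conditions.
\<close>

definition cl :: "'a set set \<Rightarrow> 'a set \<Rightarrow> 'a set" where
  "cl F X = \<Inter>{Y \<in> F. X \<subseteq> Y}"

definition F_inter :: "'a set \<Rightarrow> 'a set set \<Rightarrow> bool" where
  "F_inter P F \<longleftrightarrow> P \<in> F \<and> (\<forall>X\<in>F. \<forall>Y\<in>F. X \<inter> Y \<in> F)"

definition F_down :: "'a set \<Rightarrow> 'a rel \<Rightarrow> 'a set set \<Rightarrow> bool" where
  "F_down P r F \<longleftrightarrow> (\<forall>X\<in>F. down_set P r X)"

definition F_principal :: "'a set \<Rightarrow> 'a rel \<Rightarrow> 'a set set \<Rightarrow> bool" where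
  "F_principal P r F \<longleftrightarrow> {} \<in> F \<and> (\<forall>u\<in>P. under r u \<in> F \<and> underS r u \<in> F)"

definition covering_property :: "'a set \<Rightarrow> 'a rel \<Rightarrow> 'a set set \<Rightarrow> bool" where
  "covering_property P r F \<longleftrightarrow>
     (\<forall>u\<in>P. \<forall>X\<in>F. u \<notin> X \<and> underS r u \<subseteq> X \<longrightarrow> (\<exists>Y\<in>F. covered_in F X Y \<and> u \<in> Y))"

definition faigle_exchange_property :: "'a set \<Rightarrow> 'a rel \<Rightarrow> 'a set set \<Rightarrow> bool" where
  "faigle_exchange_property P r F \<longleftrightarrow>
     (\<forall>u\<in>P. \<forall>v\<in>P. \<forall>S\<in>F.
        u \<notin> S \<and> v \<notin> S \<and> underS r u \<subseteq> S \<and> v \<in> cl F (S \<union> {u}) \<longrightarrow> u \<in> cl F (S \<union> {v}))"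

definition faigle_geometry_lattice :: "'a set \<Rightarrow> 'a rel \<Rightarrow> 'a set set \<Rightarrow> bool" where
  "faigle_geometry_lattice P r F \<longleftrightarrow>
     F_inter P F \<and> F_down P r F \<and> F_principal P r F \<and> covering_property P r F"

definition faigle_geometry_closure :: "'a set \<Rightarrow> 'a rel \<Rightarrow> 'a set set \<Rightarrow> bool" where
  "faigle_geometry_closure P r F \<longleftrightarrow>
     F_inter P F \<and> F_down P r F \<and> F_principal P r F \<and> faigle_exchange_property P r F"

end

theory Submission
  imports Defs
begin

text \<open>Since \<open>F\<close> is finite, contains \<open>P\<close> and is closed under
  intersection, \<open>cl F X\<close> is the least member of \<open>F\<close> containing a given
  \<open>X \<subseteq> P\<close> (\<open>cl_mem\<close>, \<open>cl_subset\<close>). Hence a cover of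
  \<open>S\<close> that contains \<open>u\<close> can only be \<open>cl F (S \<union> {u})\<close>.
  That this set covers \<open>S\<close> means that each of its points \<open>v\<close> outside
  \<open>S\<close> already generates it over \<open>S\<close>, which is the exchange of
  \<open>u\<close> and \<open>v\<close>. So (CP) and (FEP) express the same fact.\<close>

lemma subset_cl: "X \<subseteq> cl F X"
  by (auto simp: cl_def)

lemma cl_subset: "Y \<in> F \<Longrightarrow> X \<subseteq> Y \<Longrightarrow> cl F X \<subseteq> Y"
  by (auto simp: cl_def)

lemma Inter_mem_if_inter_closed:
  assumes "finite A" and "A \<noteq> {}" and "A \<subseteq> F"
    and "\<And>X Y. X \<in> F \<Longrightarrow> Y \<in> F \<Longrightarrow> X \<inter> Y \<in> F"
  shows "\<Inter>A \<in> F"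
  using assms(1-3) by (induction rule: finite_ne_induct) (auto intro: assms(4))

lemma cl_mem:
  assumes "finite F" and "F_inter P F" and "X \<subseteq> P"
  shows "cl F X \<in> F"
  unfolding cl_def using assms
  by (intro Inter_mem_if_inter_closed) (auto simp: F_inter_def)

text \<open>A cover \<open>Y\<close> of \<open>S\<close> containing \<open>u\<close> also contains
  \<open>v\<close>, so no member of \<open>F\<close> lying in \<open>Y\<close> and strictly above
  \<open>S\<close> can miss \<open>u\<close>.\<close>

lemma covering_imp_exchange:
  assumes fin: "finite F" and inter: "F_inter P F" and sub: "F \<subseteq> Pow P"
    and cov: "covering_property P r F"
  shows "faigle_exchange_property P r F"
  unfolding faigle_exchange_property_def
proof (intro ballI impI, elim conjE)
  fix u v S
  assume uP: "u \<in> P" and vP: "v \<in> P" and S: "S \<in> F" and u: "u \<notin> S" and v: "v \<notin> S"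
    and below: "underS r u \<subseteq> S" and vcl: "v \<in> cl F (S \<union> {u})"
  obtain Y where Y: "covered_in F S Y" "u \<in> Y"
    using cov uP S u below unfolding covering_property_def by metis
  then have YF: "Y \<in> F" and SY: "S \<subseteq> Y" and min: "\<And>Z. Z \<in> F \<Longrightarrow> S \<subset> Z \<Longrightarrow> \<not> Z \<subset> Y"
    by (auto simp: covered_in_def)
  let ?C = "cl F (S \<union> {v})"
  have "S \<union> {v} \<subseteq> P"
    using S sub vP by auto
  \<comment> \<open>Cutting \<open>?C\<close> down to \<open>Y\<close> gives a member of
    \<open>F\<close> to which the minimality of \<open>Y\<close> over \<open>S\<close>
    applies.\<close>
  then have "?C \<inter> Y \<in> F"
    using cl_mem[OF fin inter] inter YF by (auto simp: F_inter_def)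
  moreover have "S \<subset> ?C \<inter> Y"
  proof -
    have "v \<in> Y"
      using cl_subset[OF YF, of "S \<union> {u}"] SY Y(2) vcl by auto
    then show ?thesis
      using subset_cl[of "S \<union> {v}" F] SY v by auto
  qed
  ultimately have "\<not> ?C \<inter> Y \<subset> Y"
    by (rule min)
  then show "u \<in> ?C"
    using Y(2) by auto
qed

lemma exchange_imp_covering:
  assumes fin: "finite F" and inter: "F_inter P F" and sub: "F \<subseteq> Pow P"
    and exch: "faigle_exchange_property P r F"
  shows "covering_property P r F"
  unfolding covering_property_def
proof (intro ballI impI, elim conjE)
  fix u X
  assume uP: "u \<in> P" and X: "X \<in> F" and u: "u \<notin> X" and below: "underS r u \<subseteq> X"
  \<comment> \<open>The only candidate: every member of \<open>F\<close> containing \<open>X\<close>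
    and \<open>u\<close> includes it.\<close>
  let ?Y = "cl F (X \<union> {u})"
  have "X \<union> {u} \<subseteq> P"
    using X sub uP by auto
  then have Y: "?Y \<in> F"
    by (rule cl_mem[OF fin inter])
  have XY: "X \<union> {u} \<subseteq> ?Y"
    by (rule subset_cl)
  have "\<not> (X \<subset> Z \<and> Z \<subset> ?Y)" if Z: "Z \<in> F" for Z
  proof
    assume between: "X \<subset> Z \<and> Z \<subset> ?Y"
    then obtain v where v: "v \<in> Z" "v \<notin> X"
      by blast
    have "v \<in> P" and "v \<in> ?Y"
      using v Z sub between by blast+
    \<comment> \<open>Exchange forces \<open>u\<close> into any \<open>Z\<close> strictly above
      \<open>X\<close> and below \<open>?Y\<close>; then \<open>Z\<close> includes all of
      \<open>?Y\<close>, a contradiction.\<close>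
    then have "u \<in> cl F (X \<union> {v})"
      using exch uP X u below v(2) by (simp add: faigle_exchange_property_def)
    then have "u \<in> Z"
      using cl_subset[OF Z, of "X \<union> {v}"] between v by blast
    then show False
      using cl_subset[OF Z, of "X \<union> {u}"] between by blast
  qed
  then have "covered_in F X ?Y"
    using X Y XY u by (auto simp: covered_in_def)
  then show "\<exists>Y\<in>F. covered_in F X Y \<and> u \<in> Y"
    using Y XY by blast
qed

theorem lemma2p6:
  fixes P :: "'a set" and r :: "'a rel" and F :: "'a set set"
  assumes "finite P" and "partial_order_on P r" and "F \<subseteq> Pow P"
  shows "faigle_geometry_lattice P r F \<longleftrightarrow> faigle_geometry_closure P r F"
proof -
  have "finite F"
    using assms(1,3) by (meson finite_Pow_iff finite_subset)
  then show ?thesis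
    using covering_imp_exchange[OF _ _ assms(3)] exchange_imp_covering[OF _ _ assms(3)]
    by (auto simp: faigle_geometry_lattice_def faigle_geometry_closure_def)
qed

end
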